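(* Let $H=(V,E)$ be a hypergraph on $n$ vertices, let $m=\max\{|e|:e\in E\}$ and $s_{\min}=\min\{|e|:e\in E\}$. Then $$\alpha(H)\ \ge\ \frac{4\, s_{\min}}{n^2\, m\,(m-1)\,\mathrm{diam}(H)}.$$
   Context: A (general, possibly non-uniform) hypergraph $H=(V,E)$ has vertex set $V=\{v_1,\dots,v_n\}$ and edge set $E$, a set of non-empty subsets of $V$. For an edge $e$ of cardinality $s$ let $\Omega_e=\sum \frac{m!}{k_1!\cdots k_s!}$, the sum over all $(k_1,\dots,k_s)$ with $k_j\ge 1$ and $\sum_j k_j=m$. For $e=\{v_{i_1},\dots,v_{i_s}\}$ and $x\in\mathbb{R}^n$ let $x^e_m=\sum x_{r_1}x_{r_2}\cdots x_{r_m}$, the sum over all $m$-tuples $(r_1,\dots,r_m)$ of indices from $\{i_1,\dots,i_s\}$ in which each element of this set appears at least once. Define $$\mathcal{L}x^m=\sum_{e=\{v_{i_1},\dots,v_{i_s}\}\in E}\Big(\sum_{j=1}^s x_{i_j}^m-\frac{s}{\Omega_e}x^e_m\Big)$$ (this is the form $\sum l_{i_1\dots i_m}x_{i_1}\cdots x_{i_m}$ of the Laplacian tensor $\mathcal{D}-\mathcal{A}$, where $\mathcal{D}$ is the diagonal degree tensor and $\mathcal{A}$ the order-$m$ adjacency tensor with entry $s/\Omega_e$ at every index tuple $(p_1,\dots,p_m)$ drawn from an edge $e$ of size $s$ using each of its vertices at least once). The analytic connectivity is $$\alpha(H)=\min_{j=1,\dots,n}\ \min\Big\{\mathcal{L}x^m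 : x\in\mathbb{R}^n_{+},\ \sum_{i=1}^n x_i^m=1,\ x_j=0\Big\}.$$ A path of length $\ell$ from $u$ to $v$ is a sequence of vertices $u=u_0,u_1,\dots,u_\ell=v$ with each consecutive pair $u_{t-1},u_t$ contained in a common edge; $l(u,v)$ is the length of a shortest such path and $\mathrm{diam}(H)=\max\{l(u,v):u,v\in V\}$. *)

theory Defs
  imports "HOL-Analysis.Analysis"
begin

definition hypergraph :: "'v set \<Rightarrow> 'v set set \<Rightarrow> bool" where
  "hypergraph V E \<longleftrightarrow> finite V \<and> E \<subseteq> Pow V - {{}}"

definition max_edge_size :: "'v set set \<Rightarrow> nat" where
  "max_edge_size E = Max (card ` E)"

definition min_edge_size :: "'v set set \<Rightarrow> nat" where
  "min_edge_size E = Min (card ` E)"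

definition Omega :: "nat \<Rightarrow> nat \<Rightarrow> real" where
  "Omega m s = (\<Sum>ks | length ks = s \<and> (\<forall>k\<in>set ks. 1 \<le> k) \<and> sum_list ks = m.
     fact m / (\<Prod>k\<leftarrow>ks. fact k))"

text \<open>The condition \<open>set rs = e\<close> says that the tuple \<open>rs\<close> is drawn from \<open>e\<close> and uses each of
  its elements at least once.\<close>

definition edge_monomials :: "nat \<Rightarrow> 'v set \<Rightarrow> ('v \<Rightarrow> real) \<Rightarrow> real" where
  "edge_monomials m e x = (\<Sum>rs | length rs = m \<and> set rs = e. \<Prod>r\<leftarrow>rs. x r)"

definition laplacian_form :: "'v set set \<Rightarrow> nat \<Rightarrow> ('v \<Rightarrow> real) \<Rightarrow> real" where
  "laplacian_form E m x =
     (\<Sum>e\<in>E. (\<Sum>i\<in>e. x i ^ m) - real (card e) / Omega m (card e) * edge_monomials m e x)"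

text \<open>Vectors of the nonnegative orthant are functions on \<open>V\<close>, undefined outside \<open>V\<close>.\<close>

definition feasible :: "'v set \<Rightarrow> nat \<Rightarrow> 'v \<Rightarrow> ('v \<Rightarrow> real) set" where
  "feasible V m j = {x \<in> V \<rightarrow>\<^sub>E {0..}. (\<Sum>i\<in>V. x i ^ m) = 1 \<and> x j = 0}"

text \<open>The inner infimum is a minimum as soon as \<open>V\<close> has two elements and
  \<open>m > 0\<close>; see \<open>feasible_nonempty\<close> and \<open>laplacian_form_attains_min\<close> below.\<close>

definition analytic_connectivity :: "'v set \<Rightarrow> 'v set set \<Rightarrow> real" where
  "analytic_connectivity V E =
     (MIN j\<in>V. INF x\<in>feasible V (max_edge_size E) j. laplacian_form E (max_edge_size E) x)"

definition hyperpath :: "'v set \<Rightarrow> 'v set set \<Rightarrow> 'v \<Rightarrow> 'v list \<Rightarrow> 'v \<Rightarrow> bool" where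
  "hyperpath V E u us v \<longleftrightarrow> us \<noteq> [] \<and> set us \<subseteq> V \<and> hd us = u \<and> last us = v \<and>
     successively (\<lambda>a b. \<exists>e\<in>E. a \<in> e \<and> b \<in> e) us"

text \<open>A path of length \<open>l\<close> lists \<open>l + 1\<close> vertices. The distance is \<open>\<infinity>\<close> if there is no path.\<close>

definition hdist :: "'v set \<Rightarrow> 'v set set \<Rightarrow> 'v \<Rightarrow> 'v \<Rightarrow> enat" where
  "hdist V E u v = (INF us\<in>{us. hyperpath V E u us v}. enat (length us - 1))"

definition hdiam :: "'v set \<Rightarrow> 'v set set \<Rightarrow> enat" where
  "hdiam V E = (MAX u\<in>V. MAX v\<in>V. hdist V E u v)"

text \<open>The index sets of the sums above are finite, so none of these sums is 0 by convention.\<close>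

lemma finite_compositions:
  "finite {ks :: nat list. length ks = s \<and> (\<forall>k\<in>set ks. 1 \<le> k) \<and> sum_list ks = m}"
proof (rule finite_subset)
  show "{ks :: nat list. length ks = s \<and> (\<forall>k\<in>set ks. 1 \<le> k) \<and> sum_list ks = m}
      \<subseteq> {ks. set ks \<subseteq> {..m} \<and> length ks = s}"
    using member_le_sum_list by auto
  show "finite {ks :: nat list. set ks \<subseteq> {..m} \<and> length ks = s}"
    by (rule finite_lists_length_eq) simp
qed

lemma finite_edge_tuples:
  assumes "finite e"
  shows "finite {rs. length rs = m \<and> set rs = e}"
  by (rule finite_subset[OF _ finite_lists_length_eq[OF assms, of m]]) auto

lemma feasible_nonempty:
  assumes "finite V" "2 \<le> card V" "0 < m" "j \<in> V"
  shows "feasible V m j \<noteq> {}"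
proof -
  obtain k where k: "k \<in> V" "k \<noteq> j"
    using assms by (metis One_nat_def card_le_Suc0_iff_eq not_less_eq_eq numeral_2_eq_2)
  define x where "x = restrict (\<lambda>i. if i = k then 1 else (0::real)) V"
  have "(\<Sum>i\<in>V. x i ^ m) = (\<Sum>i\<in>V. if i = k then 1 else 0)"
    using assms by (intro sum.cong) (auto simp: x_def)
  also have "\<dots> = 1"
    using assms k by simp
  finally have "x \<in> feasible V m j"
    using k assms by (auto simp: feasible_def x_def)
  then show ?thesis by blast
qed

lemma continuous_on_prod_list_coord:
  "continuous_on UNIV (\<lambda>x :: 'v \<Rightarrow> real. \<Prod>r\<leftarrow>rs. x r)"
proof (induction rs)
  case (Cons r rs)
  then show ?case
    by (auto intro!: continuous_intros continuous_on_product_coordinates)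
qed simp

lemma continuous_on_laplacian_form:
  "continuous_on UNIV (laplacian_form E m)"
  unfolding laplacian_form_def edge_monomials_def
  by (intro continuous_intros continuous_on_product_coordinates continuous_on_prod_list_coord)

lemma compact_feasible:
  assumes "finite V" "0 < m"
  shows "compact (feasible V m j)"
proof -
  define B where "B = (\<lambda>i. if i \<in> V then {0..1} else {undefined :: real})"
  have le1: "x i \<le> 1" if "x \<in> feasible V m j" "i \<in> V" for x i
  proof -
    have "x i ^ m \<le> (\<Sum>i\<in>V. x i ^ m)"
      using that assms(1) by (intro member_le_sum) (auto simp: feasible_def PiE_def Pi_def)
    then have "x i ^ m \<le> 1"
      using that by (auto simp: feasible_def)
    then show ?thesis
      using assms(2) one_less_power[of "x i" m] by fastforce
  qed
  have "feasible V m j = PiE UNIV B \<inter> ({x. (\<Sum>i\<in>V. x i ^ m) = 1} \<inter> {x. x j = 0})"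
    (is "_ = ?R")
  proof
    show "feasible V m j \<subseteq> ?R"
      using le1 by (auto simp: B_def feasible_def PiE_def extensional_def)
    show "?R \<subseteq> feasible V m j"
      by (auto simp: B_def feasible_def PiE_def extensional_def Pi_def split: if_splits)
  qed
  moreover have "compact (PiE UNIV B)"
    using compactin_PiE[of "\<lambda>_. euclidean" UNIV B]
    by (simp add: euclidean_product_topology B_def)
  moreover have "closed {x :: 'a \<Rightarrow> real. (\<Sum>i\<in>V. x i ^ m) = 1}"
    by (intro closed_Collect_eq continuous_intros continuous_on_product_coordinates)
  moreover have "closed {x :: 'a \<Rightarrow> real. x j = 0}"
    by (intro closed_Collect_eq continuous_intros continuous_on_product_coordinates)
  ultimately show ?thesis
    by (simp add: compact_Int_closed closed_Int)
qed

lemma laplacian_form_attains_min: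
  assumes "finite V" "0 < m" "feasible V m j \<noteq> {}"
  shows "\<exists>x\<in>feasible V m j. laplacian_form E m x = (INF y\<in>feasible V m j. laplacian_form E m y)
    \<and> (\<forall>y\<in>feasible V m j. laplacian_form E m x \<le> laplacian_form E m y)"
proof -
  obtain x where x: "x \<in> feasible V m j"
    "\<forall>y\<in>feasible V m j. laplacian_form E m x \<le> laplacian_form E m y"
    using continuous_attains_inf[OF compact_feasible[OF assms(1,2)] assms(3)]
      continuous_on_subset[OF continuous_on_laplacian_form] by blast
  then have "(INF y\<in>feasible V m j. laplacian_form E m y) = laplacian_form E m x"
    by (intro cInf_eq_minimum) auto
  with x show ?thesis by auto
qed

end

theory Submission
  imports Defs "HOL-Combinatorics.Multiset_Permutations"
begin

text \<open>Put \<open>y i = sqrt (x i ^ m)\<close>. For an \<open>m\<close>-tuple \<open>r\<close> running through all of an edge \<open>e\<close>, AM-GM over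
  the ordered pairs of distinct positions bounds \<open>x r\<^sub>1 \<cdots> x r\<^sub>m\<close> by the mean of the products
  \<open>y r\<^sub>p * y r\<^sub>q\<close>. Since there are \<open>\<Omega>\<close> such tuples and they treat the vertices of \<open>e\<close> alike,
  summation shows that the edge \<open>e\<close> contributes at least \<open>|e| / (m (m - 1)) * (y a - y b)\<^sup>2\<close> to the form,
  for any \<open>a, b \<in> e\<close>. Now let \<open>x j = 0\<close>. Some vertex \<open>i\<close> has \<open>x i ^ m \<ge> 1 / (n - 1) \<ge> 4 / n\<^sup>2\<close>, and
  Cauchy-Schwarz along a path from \<open>j\<close> to \<open>i\<close> with at most \<open>diam\<close> edges gives the bound.\<close>

section \<open>Products and pairwise differences along one tuple\<close>

text \<open>Expanding the squares leaves minus the sum of all products \<open>y p * y q\<close>. Its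
  diagonal absorbs one of the \<open>m\<close> copies of the sum of \<open>(y p)\<^sup>2\<close>,
  whence the factor \<open>m - 1\<close>, and AM-GM bounds the off-diagonal rest from below.\<close>

lemma prod_le_mean_pairs:
  fixes x y :: "nat \<Rightarrow> real"
  assumes m: "2 \<le> m" and x: "\<And>p. p < m \<Longrightarrow> 0 \<le> x p"
    and y: "\<And>p. y p = sqrt (x p ^ m)"
  shows "(\<Sum>p<m. \<Sum>q<m. (y p - y q)\<^sup>2) / 2 \<le> (real m - 1) * ((\<Sum>p<m. x p ^ m) - real m * (\<Prod>p<m. x p))"
proof -
  define P where "P = (SIGMA p:{..<m}. {..<m} - {p})"
  define N where "N = m * (m - 1)"
  have finP: "finite P" and cardP: "card P = N"
    by (simp_all add: P_def N_def)
  have N: "0 < N" "real N = real m * (real m - 1)"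
    using m by (simp_all add: N_def of_nat_diff)
  have y0: "0 \<le> y p" if "p < m" for p
    using x that by (simp add: y)
  have y2: "(y p)\<^sup>2 = x p ^ m" if "p < m" for p
    using x that by (simp add: y)
  have x0: "0 \<le> (\<Prod>p<m. x p)"
    using x by (intro prod_nonneg) auto
  \<comment> \<open>Each \<open>y p\<close> occurs in \<open>m - 1\<close> pairs as first and in as
    many as second entry, so the product over \<open>P\<close> is the power \<open>N\<close> of the
    product of all \<open>x p\<close>, and taking the \<open>N\<close>-th root removes
    \<open>y\<close>.\<close>
  have fst: "(\<Prod>(p, q)\<in>P. y p) = (\<Prod>p<m. y p) ^ (m - 1)"
    unfolding P_def by (subst prod.Sigma[symmetric]) (simp_all add: prod_power_distrib)
  have "(\<Prod>(p, q)\<in>P. y q) = (\<Prod>(p, q)\<in>P. y p)"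
    by (rule prod.reindex_bij_witness[of _ prod.swap prod.swap]) (auto simp: P_def)
  then have "(\<Prod>(p, q)\<in>P. y p * y q) = ((\<Prod>p<m. y p) ^ (m - 1))\<^sup>2"
    using fst by (simp add: case_prod_unfold prod.distrib power2_eq_square)
  also have "\<dots> = (\<Prod>p<m. (y p)\<^sup>2) ^ (m - 1)"
    by (simp add: prod_power_distrib flip: power_mult) (simp add: mult.commute)
  also have "\<dots> = (\<Prod>p<m. x p) ^ N"
    by (simp add: y2 prod_power_distrib N_def flip: power_mult)
  finally have "(\<Prod>p<m. x p) = (\<Prod>(p, q)\<in>P. y p * y q) powr (1 / card P)"
    using N(1) x0 real_root_power_cancel[of N "\<Prod>p<m. x p"]
      root_powr_inverse[of N "(\<Prod>p<m. x p) ^ N"]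
    by (simp add: cardP)
  also have "\<dots> \<le> (\<Sum>(p, q)\<in>P. y p * y q / card P)"
    using arith_geom_mean[of P "\<lambda>(p, q). y p * y q"] finP cardP N y0
    by (force simp: P_def case_prod_unfold)
  also have "\<dots> = (\<Sum>(p, q)\<in>P. y p * y q) / N"
    by (simp add: cardP sum_divide_distrib case_prod_unfold)
  finally have *: "real N * (\<Prod>p<m. x p) \<le> (\<Sum>(p, q)\<in>P. y p * y q)"
    using N(1) by (simp add: field_simps)
  have "(\<Sum>(p, q)\<in>P. y p * y q) = (\<Sum>p<m. \<Sum>q\<in>{..<m}-{p}. y p * y q)"
    unfolding P_def by (subst sum.Sigma) simp_all
  also have "\<dots> = (\<Sum>p<m. (\<Sum>q<m. y p * y q) - (y p)\<^sup>2)"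
    by (intro sum.cong) (simp_all add: sum_diff1 power2_eq_square)
  finally have pairs: "(\<Sum>(p, q)\<in>P. y p * y q) = (\<Sum>p<m. \<Sum>q<m. y p * y q) - (\<Sum>p<m. (y p)\<^sup>2)"
    by (simp add: sum_subtractf)
  have "(\<Sum>p<m. \<Sum>q<m. (y p - y q)\<^sup>2)
      = 2 * (real m * (\<Sum>p<m. (y p)\<^sup>2) - (\<Sum>p<m. \<Sum>q<m. y p * y q))"
    by (simp add: power2_diff sum.distrib sum_subtractf sum_distrib_left algebra_simps)
  also have "\<dots> \<le> 2 * ((real m - 1) * (\<Sum>p<m. (y p)\<^sup>2) - real N * (\<Prod>p<m. x p))"
    using * pairs by (simp add: algebra_simps)
  finally show ?thesis
    by (simp add: y2 N algebra_simps)
qed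

lemma prod_list_le_mean:
  fixes x :: "'v \<Rightarrow> real"
  assumes m: "2 \<le> length rs" and x: "\<And>i. i \<in> set rs \<Longrightarrow> 0 \<le> x i"
    and ab: "a \<in> set rs" "b \<in> set rs"
  shows "(sqrt (x a ^ length rs) - sqrt (x b ^ length rs))\<^sup>2
    \<le> (real (length rs) - 1) * ((\<Sum>r\<leftarrow>rs. x r ^ length rs) - real (length rs) * (\<Prod>r\<leftarrow>rs. x r))"
    (is "?d \<le> _")
proof -
  define m where "m = length rs"
  define y where "y p = sqrt (x (rs ! p) ^ m)" for p
  obtain p q where pq: "p < m" "rs ! p = a" "q < m" "rs ! q = b"
    using ab unfolding m_def by (metis in_set_conv_nth)
  \<comment> \<open>Keeping only \<open>(p, q)\<close> and \<open>(q, p)\<close> cancels the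
    halving. If \<open>p = q\<close> the set is a singleton, but then the difference
    vanishes.\<close>
  have "(\<Sum>(p, q)\<in>{(p, q), (q, p)}. (y p - y q)\<^sup>2) \<le> (\<Sum>(p, q)\<in>{..<m} \<times> {..<m}. (y p - y q)\<^sup>2)"
    using pq by (intro sum_mono2) auto
  then have "2 * (y p - y q)\<^sup>2 \<le> (\<Sum>p<m. \<Sum>q<m. (y p - y q)\<^sup>2)"
    by (cases "p = q") (simp_all add: sum.cartesian_product power2_commute)
  moreover have "(y p - y q)\<^sup>2 = ?d"
    using pq by (simp add: y_def m_def)
  ultimately have "?d \<le> (\<Sum>p<m. \<Sum>q<m. (y p - y q)\<^sup>2) / 2" by simp
  also have "\<dots> \<le> (real m - 1) * ((\<Sum>p<m. x (rs ! p) ^ m) - real m * (\<Prod>p<m. x (rs ! p)))"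
    using m x by (intro prod_le_mean_pairs) (auto simp: m_def y_def)
  finally show ?thesis
    by (simp add: m_def prod.list_conv_set_nth sum.list_conv_set_nth atLeast0LessThan)
qed

section \<open>Tuples running through an edge\<close>

text \<open>Multisets link both sides: along an enumeration \<open>vs\<close> of \<open>e\<close>, a
  composition of \<open>m\<close> lists the multiplicities of a multiset of size \<open>m\<close>
  with support \<open>e\<close>, and its multinomial coefficient counts the orderings of that
  multiset.\<close>

lemma Omega_eq_card:
  assumes e: "finite e"
  shows "Omega m (card e) = real (card {rs. length rs = m \<and> set rs = e})"
proof -
  obtain vs where vs: "set vs = e" "distinct vs"
    using finite_distinct_list[OF e] by blast
  have len: "length vs = card e"
    using vs distinct_card by fastforce
  define K where "K = {ks :: nat list. length ks = card e \<and> (\<forall>k\<in>set ks. 1 \<le> k) \<and> sum_list ks = m}"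
  define \<M> where "\<M> = {M. size M = m \<and> set_mset M = e}"
  have bij: "bij_betw (\<lambda>M. map (count M) vs) \<M> K"
    unfolding bij_betw_def
  proof
    show "inj_on (\<lambda>M. map (count M) vs) \<M>"
    proof (rule inj_onI)
      fix M M' assume M: "M \<in> \<M>" "M' \<in> \<M>" "map (count M) vs = map (count M') vs"
      then have "count M i = count M' i" for i
        using vs by (cases "i \<in> e") (auto simp: \<M>_def, metis not_in_iff)
      then show "M = M'" by (simp add: multiset_eqI)
    qed
    show "(\<lambda>M. map (count M) vs) ` \<M> = K"
    proof (intro subset_antisym subsetI)
      fix ks assume "ks \<in> (\<lambda>M. map (count M) vs) ` \<M>"
      then obtain M where M: "M \<in> \<M>" "ks = map (count M) vs" by blast
      then have "sum_list ks = m"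
        using vs by (auto simp: \<M>_def size_multiset_overloaded_eq sum.distinct_set_conv_list[symmetric])
      then show "ks \<in> K"
        using M vs len by (auto simp: K_def \<M>_def Suc_le_eq)
    next
      fix ks assume ks: "ks \<in> K"
      \<comment> \<open>The preimage of \<open>ks\<close> under the count map. As \<open>vs\<close>
        is distinct, only one summand contributes to each count.\<close>
      define M where "M = (\<Sum>i<card e. replicate_mset (ks ! i) (vs ! i))"
      have cnt: "count M (vs ! j) = ks ! j" if "j < card e" for j
      proof -
        have "count M (vs ! j) = (\<Sum>i<card e. if i = j then ks ! i else 0)"
          unfolding M_def count_sum
          using that vs len by (intro sum.cong) (auto simp: nth_eq_iff_index_eq)
        then show ?thesis using that by simp
      qed
      then have "map (count M) vs = ks"
        using ks len by (auto simp: K_def intro: nth_equalityI)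
      moreover have "size M = m"
        using ks by (auto simp: M_def K_def size_multiset_sum sum_list_sum_nth atLeast0LessThan)
      moreover have "set_mset M = e"
      proof -
        have "set_mset M = (\<Union>i<card e. set_mset (replicate_mset (ks ! i) (vs ! i)))"
          by (simp add: M_def set_mset_sum)
        \<comment> \<open>The parts are positive, so no vertex of \<open>e\<close> is lost.\<close>
        also have "\<dots> = (\<Union>i<card e. {vs ! i})"
          using ks by (intro SUP_cong) (fastforce simp: K_def set_conv_nth)+
        also have "\<dots> = e"
          using vs(1) len by (auto simp: set_conv_nth)
        finally show ?thesis .
      qed
      ultimately show "ks \<in> (\<lambda>M. map (count M) vs) ` \<M>"
        by (auto simp: \<M>_def intro!: image_eqI[of _ _ M])
    qed
  qed
  have fin: "finite \<M>"
    using bij_betw_finite[OF bij] finite_compositions unfolding K_def by blast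
  have perms: "fact m / (\<Prod>k\<leftarrow>map (count M) vs. fact k)
      = real (card (permutations_of_multiset M))" if "M \<in> \<M>" for M
  proof -
    have "(\<Prod>k\<leftarrow>map (count M) vs. fact k) = (\<Prod>i\<in>e. fact (count M i) :: real)"
      using vs by (simp add: prod.distinct_set_conv_list[symmetric] o_def)
    moreover have "real (card (permutations_of_multiset M)) * (\<Prod>i\<in>e. fact (count M i)) = fact m"
      using that arg_cong[OF card_permutations_of_multiset_aux[of M], of real]
      by (simp add: \<M>_def)
    ultimately show ?thesis
      using e by (simp add: divide_eq_eq)
  qed
  have "Omega m (card e) = (\<Sum>M\<in>\<M>. real (card (permutations_of_multiset M)))"
    unfolding Omega_def K_def[symmetric]
    by (subst sum.reindex_bij_betw[OF bij, symmetric]) (rule sum.cong[OF refl perms])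
  \<comment> \<open>A tuple determines its multiset, so the union is disjoint.\<close>
  also have "\<dots> = real (card (\<Union>M\<in>\<M>. permutations_of_multiset M))"
    using fin by (subst card_UN_disjoint) (auto dest: permutations_of_multisetD)
  also have "(\<Union>M\<in>\<M>. permutations_of_multiset M) = {rs. length rs = m \<and> set rs = e}"
    by (auto simp: \<M>_def permutations_of_multiset_def)
  finally show ?thesis .
qed

text \<open>Needed to cancel \<open>Omega\<close> in the edge form: an enumeration of
  \<open>e\<close>, padded to length \<open>m\<close> by its head, is one of the tuples
  counted.\<close>

lemma Omega_pos:
  assumes "finite e" "e \<noteq> {}" "card e \<le> m"
  shows "0 < Omega m (card e)"
proof -
  obtain vs where vs: "set vs = e" "distinct vs"
    using finite_distinct_list[OF assms(1)] by blast
  then have "vs @ replicate (m - card e) (hd vs) \<in> {rs. length rs = m \<and> set rs = e}"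
    using assms distinct_card[of vs] hd_in_set[of vs] by auto
  then have "card {rs. length rs = m \<and> set rs = e} > 0"
    using finite_edge_tuples[OF assms(1)] by (metis card_gt_0_iff empty_iff)
  then show ?thesis
    by (simp add: Omega_eq_card assms)
qed

lemma sum_list_map_eq_sum_count_real:
  fixes f :: "'v \<Rightarrow> real"
  shows "(\<Sum>r\<leftarrow>rs. f r) = (\<Sum>i\<in>set rs. real (count_list rs i) * f i)"
proof (induction rs)
  case (Cons r rs)
  have "(\<Sum>i\<in>set rs - {r}. real (count_list (r # rs) i) * f i)
      = (\<Sum>i\<in>set rs - {r}. real (count_list rs i) * f i)"
    by (intro sum.cong) auto
  with Cons show ?case
    by (cases "r \<in> set rs") (simp_all add: insert_absorb sum.remove[of _ r] algebra_simps)
qed simp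

text \<open>Double counting: transposing two vertices of \<open>e\<close> permutes the tuples, so
  each vertex occurs equally often, and all occurrences together number
  \<open>m * Omega m (card e)\<close>.\<close>

lemma sum_edge_tuples:
  fixes g :: "'v \<Rightarrow> real"
  assumes e: "finite e"
  shows "real (card e) * (\<Sum>rs | length rs = m \<and> set rs = e. \<Sum>r\<leftarrow>rs. g r)
    = real m * Omega m (card e) * (\<Sum>i\<in>e. g i)"
proof -
  define T where "T = {rs. length rs = m \<and> set rs = e}"
  define c where "c i = (\<Sum>rs\<in>T. real (count_list rs i))" for i
  have eq: "(\<Sum>rs\<in>T. \<Sum>r\<leftarrow>rs. f r) = (\<Sum>i\<in>e. c i * f i)" for f :: "'v \<Rightarrow> real"
  proof -
    have "(\<Sum>rs\<in>T. \<Sum>r\<leftarrow>rs. f r) = (\<Sum>rs\<in>T. \<Sum>i\<in>e. count_list rs i * f i)"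
      by (intro sum.cong) (auto simp: T_def sum_list_map_eq_sum_count_real)
    also have "\<dots> = (\<Sum>i\<in>e. c i * f i)"
      by (subst sum.swap) (simp add: c_def sum_distrib_right)
    finally show ?thesis .
  qed
  have cc: "c i = c j" if "i \<in> e" "j \<in> e" for i j
  proof -
    let ?t = "map (Transposition.transpose i j)"
    have im: "Transposition.transpose i j ` e = e"
      using that by (simp add: transpose_image_eq)
    have "count_list (?t rs) j = count_list rs i" for rs
      using count_list_map_conv[of "Transposition.transpose i j" rs i] by simp
    moreover have "?t (?t rs) = rs" for rs :: "'v list"
      by (simp add: o_def)
    ultimately show ?thesis
      unfolding c_def
      by (intro sum.reindex_bij_witness[of _ ?t ?t]) (auto simp: T_def im simp del: map_map)
  qed
  have tot: "(\<Sum>i\<in>e. c i) = real m * Omega m (card e)"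
  proof -
    \<comment> \<open>With weight 1, \<open>eq\<close> counts the positions of all tuples.\<close>
    have "(\<Sum>i\<in>e. c i) = (\<Sum>rs\<in>T. \<Sum>r\<leftarrow>rs. 1)"
      by (simp add: eq[of "\<lambda>_. 1"])
    also have "\<dots> = (\<Sum>rs\<in>T. real m)"
      by (intro sum.cong) (auto simp: T_def sum_list_triv)
    finally show ?thesis
      using e by (simp add: Omega_eq_card T_def)
  qed
  have const: "real (card e) * c i = real m * Omega m (card e)" if "i \<in> e" for i
    using tot cc[OF that] by (metis (mono_tags, lifting) sum.cong sum_constant)
  have "real (card e) * (\<Sum>rs\<in>T. \<Sum>r\<leftarrow>rs. g r) = (\<Sum>i\<in>e. (real (card e) * c i) * g i)"
    by (simp add: eq sum_distrib_left mult.assoc)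
  also have "\<dots> = real m * Omega m (card e) * (\<Sum>i\<in>e. g i)"
    by (simp add: const sum_distrib_left)
  finally show ?thesis by (simp add: T_def)
qed

section \<open>Lower bound for a single edge\<close>

definition edge_form :: "nat \<Rightarrow> 'v set \<Rightarrow> ('v \<Rightarrow> real) \<Rightarrow> real" where
  "edge_form m e x = (\<Sum>i\<in>e. x i ^ m) - real (card e) / Omega m (card e) * edge_monomials m e x"

text \<open>\<open>prod_list_le_mean\<close> is summed over all tuples, where
  \<open>sum_edge_tuples\<close> evaluates the power sums. The choice \<open>a = b\<close> gives
  nonnegativity of the edge form.\<close>

lemma edge_form_lower_bound:
  assumes e: "finite e" "card e \<le> m" and m: "2 \<le> m"
    and x: "\<And>i. i \<in> e \<Longrightarrow> 0 \<le> x i" and ab: "a \<in> e" "b \<in> e"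
  shows "real (card e) / (real m * (real m - 1)) * (sqrt (x a ^ m) - sqrt (x b ^ m))\<^sup>2
    \<le> edge_form m e x"
proof -
  define T where "T = {rs. length rs = m \<and> set rs = e}"
  define d where "d = (sqrt (x a ^ m) - sqrt (x b ^ m))\<^sup>2"
  define S where "S = (\<Sum>i\<in>e. x i ^ m)"
  define Q where "Q = edge_monomials m e x"
  let ?\<Omega> = "Omega m (card e)"
  have O: "0 < ?\<Omega>" using e ab by (intro Omega_pos) auto
  have s: "0 < real (card e)" using e ab by (auto simp: card_gt_0_iff)
  have "?\<Omega> * d = (\<Sum>rs\<in>T. d)"
    using e by (simp add: Omega_eq_card T_def)
  also have "\<dots> \<le> (\<Sum>rs\<in>T. (real m - 1) * ((\<Sum>r\<leftarrow>rs. x r ^ m) - real m * (\<Prod>r\<leftarrow>rs. x r)))"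
  proof (rule sum_mono)
    fix rs assume "rs \<in> T"
    then show "d \<le> (real m - 1) * ((\<Sum>r\<leftarrow>rs. x r ^ m) - real m * (\<Prod>r\<leftarrow>rs. x r))"
      using prod_list_le_mean[of rs x a b] m x ab by (auto simp: T_def d_def)
  qed
  also have "\<dots> = (real m - 1) * ((\<Sum>rs\<in>T. \<Sum>r\<leftarrow>rs. x r ^ m) - real m * Q)"
    by (simp add: sum_subtractf sum_distrib_left Q_def edge_monomials_def T_def right_diff_distrib)
  also have "(\<Sum>rs\<in>T. \<Sum>r\<leftarrow>rs. x r ^ m) = real m * ?\<Omega> * S / card e"
    using sum_edge_tuples[OF e(1), where m = m and g = "\<lambda>i. x i ^ m"] s
    by (simp add: T_def S_def field_simps)
  finally have "?\<Omega> * d \<le> (real m - 1) * (real m * ?\<Omega> * S / card e - real m * Q)" .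
  \<comment> \<open>This factor turns the sum over tuples into \<open>m * (m - 1)\<close> times the
    edge form and leaves \<open>card e * d\<close> on the left.\<close>
  then have "real (card e) / ?\<Omega> * (?\<Omega> * d)
      \<le> real (card e) / ?\<Omega> * ((real m - 1) * (real m * ?\<Omega> * S / card e - real m * Q))"
    using O by (intro mult_left_mono) auto
  also have "\<dots> = (real m * (real m - 1)) * (S - real (card e) / ?\<Omega> * Q)"
    using O s by (simp add: field_simps)
  finally have "real (card e) * d \<le> (real m * (real m - 1)) * edge_form m e x"
    using O by (simp add: edge_form_def S_def Q_def)
  then show ?thesis
    using m by (simp add: d_def field_simps)
qed

section \<open>Charging edges along a walk\<close>

text \<open>A walk may use an edge several times. Leaving that edge at the last vertex of the walk lying
  in it, one finds that every edge has to be charged only once.\<close>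

lemma walk_increment_le:
  fixes f :: "'v \<Rightarrow> real"
  assumes "successively (\<lambda>a b. \<exists>e\<in>F. a \<in> e \<and> b \<in> e) us" "us \<noteq> []" "finite F"
    and "\<And>e a b. e \<in> F \<Longrightarrow> a \<in> e \<Longrightarrow> b \<in> e \<Longrightarrow> f b - f a \<le> h e"
  shows "\<exists>G\<subseteq>F. card G \<le> length us - 1 \<and> f (last us) - f (hd us) \<le> (\<Sum>e\<in>G. h e)"
  using assms
\<comment> \<open>\<open>F\<close> varies, since the rest of the walk uses only
  \<open>F - {e}\<close>.\<close>
proof (induction us arbitrary: F rule: length_induct)
  case (1 us)
  show ?case
  proof (cases "length us \<le> 1")
    case True
    with 1(3) have "last us = hd us"
      by (cases us) auto
    then show ?thesis by (intro exI[of _ "{}"]) auto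
  next
    case False
    then obtain u w ws where us: "us = u # w # ws"
      by (metis One_nat_def length_Cons le_numeral_extra(4) list.exhaust list.size(3) zero_le_one)
    with 1(2) obtain e where e: "e \<in> F" "u \<in> e" "w \<in> e" by auto
    then have "\<exists>z\<in>set us. z \<in> e" by (auto simp: us)
    then obtain pre z post where z: "us = pre @ z # post" "z \<in> e" "\<forall>v\<in>set post. v \<notin> e"
      by (auto elim!: split_list_last_propE)
    \<comment> \<open>If \<open>pre\<close> were empty, then \<open>z = u\<close> and
      \<open>post\<close> would contain \<open>w\<close>, which lies in \<open>e\<close>.\<close>
    have pre: "pre \<noteq> []"
      using z e by (auto simp: us)
    have succ: "successively (\<lambda>a b. \<exists>e\<in>F. a \<in> e \<and> b \<in> e) (z # post)"
      using 1(2) by (simp add: z successively_append_iff)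
    \<comment> \<open>Every step after \<open>z\<close> ends in \<open>post\<close>, outside
      \<open>e\<close>, so its edge is not \<open>e\<close>.\<close>
    have "successively (\<lambda>a b. \<exists>e'\<in>F - {e}. a \<in> e' \<and> b \<in> e') (z # post)"
    proof (cases post)
      case (Cons c cs)
      have "successively (\<lambda>a b. \<exists>e'\<in>F - {e}. a \<in> e' \<and> b \<in> e') post"
        by (rule successively_mono[of "\<lambda>a b. \<exists>e\<in>F. a \<in> e \<and> b \<in> e"])
          (use succ z(3) Cons in auto)
      then show ?thesis
        using succ z(3) Cons by auto
    qed simp
    moreover have "length (z # post) < length us"
      using pre by (simp add: z)
    ultimately obtain G where G: "G \<subseteq> F - {e}" "card G \<le> length post"
        "f (last (z # post)) - f z \<le> (\<Sum>e\<in>G. h e)"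
      using 1(1)[rule_format, of "z # post" "F - {e}"] 1(4,5) by auto
    have "finite G" using G(1) 1(4) by (auto intro: finite_subset)
    moreover have "e \<notin> G" using G(1) by auto
    moreover have "f z - f u \<le> h e" using 1(5) e z by auto
    moreover have "hd us = u" "last us = last (z # post)"
      by (simp_all add: us) (metis last_appendR list.distinct(1) us z(1) last.simps)
    ultimately have "f (last us) - f (hd us) \<le> (\<Sum>e\<in>insert e G. h e)"
      using G(3) by simp
    \<comment> \<open>Dropping the nonempty \<open>pre\<close> shortens the walk by at least one
      step, which pays for \<open>e\<close>.\<close>
    moreover have "card (insert e G) \<le> length us - 1"
      using pre \<open>finite G\<close> \<open>e \<notin> G\<close> G(2) by (cases pre) (auto simp: z)
    moreover have "insert e G \<subseteq> F"
      using G(1) e(1) by blast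
    ultimately show ?thesis by blast
  qed
qed

text \<open>A finite bound excludes the empty set of paths, whose infimum is
  \<open>\<infinity>\<close>, and a nonempty set in \<open>enat\<close> attains its infimum.\<close>

lemma hdist_path:
  assumes "hdist V E u v \<le> enat D"
  obtains us where "hyperpath V E u us v" "length us - 1 \<le> D"
proof -
  let ?A = "(\<lambda>us. enat (length us - 1)) ` {us. hyperpath V E u us v}"
  have "Inf ?A \<noteq> \<infinity>"
    using assms unfolding hdist_def by (metis enat_ord_simps(5) infinity_ne_i0 enat.distinct(1))
  then have "?A \<noteq> {}"
    by (metis Inf_empty top_enat_def)
  then have "Inf ?A \<in> ?A"
    by (simp only: Inf_enat_def if_False) (metis LeastI ex_in_conv)
  then show thesis
    using assms that by (auto simp: hdist_def)
qed

section \<open>From single edges to the whole form\<close>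

text \<open>The claim \<open>0 < D\<close> is kept separate because a positive number divided by 0
  is 0 in \<open>real\<close> but \<open>\<infinity>\<close> in \<open>ereal\<close>, so the final
  quotient needs a nonzero diameter.\<close>

lemma laplacian_form_lower_bound:
  fixes V :: "'v set"
  assumes H: "hypergraph V E" and m: "2 \<le> m" and edges: "\<And>e. e \<in> E \<Longrightarrow> s \<le> card e \<and> card e \<le> m"
    and s: "0 < s" and x: "x \<in> feasible V m j" and j: "j \<in> V" and D: "hdiam V E = enat D"
  shows "0 < D \<and> 4 * real s / ((real (card V))\<^sup>2 * real m * (real m - 1) * real D) \<le> laplacian_form E m x"
proof -
  define n where "n = card V"
  define f where "f i = sqrt (x i ^ m)" for i
  \<comment> \<open>The constant of \<open>edge_form_lower_bound\<close> with \<open>card e\<close>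
    replaced by its lower bound \<open>s\<close>; \<open>h e\<close> then bounds the variation of
    \<open>f\<close> on \<open>e\<close>.\<close>
  define c where "c = real s / (real m * (real m - 1))"
  define h where "h e = sqrt (edge_form m e x / c)" for e
  have finV: "finite V" and finE: "finite E"
    using H by (auto simp: hypergraph_def intro: finite_subset)
  have sub: "e \<subseteq> V" "finite e" if "e \<in> E" for e
    using H that by (auto simp: hypergraph_def intro: finite_subset)
  have x0: "0 \<le> x i" if "i \<in> V" for i
    using x that by (auto simp: feasible_def)
  have sum1: "(\<Sum>i\<in>V. x i ^ m) = 1" and xj: "x j = 0"
    using x by (auto simp: feasible_def)
  have c: "0 < c" using s m by (simp add: c_def)
  have lower: "c * (f b - f a)\<^sup>2 \<le> edge_form m e x" if "e \<in> E" "a \<in> e" "b \<in> e" for e a b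
  proof -
    have "c * (f b - f a)\<^sup>2 \<le> real (card e) / (real m * (real m - 1)) * (f b - f a)\<^sup>2"
      unfolding c_def using edges[OF that(1)] m by (intro mult_right_mono divide_right_mono) auto
    also have "\<dots> \<le> edge_form m e x"
      unfolding f_def using that sub[OF that(1)] edges[OF that(1)] m x0
      by (intro edge_form_lower_bound) auto
    finally show ?thesis .
  qed
  have form0: "0 \<le> edge_form m e x" if "e \<in> E" for e
  proof -
    have "e \<noteq> {}" using edges[OF that] s by auto
    then obtain a where "a \<in> e" by blast
    then show ?thesis using lower[OF that, of a a] by simp
  qed
  have h: "f b - f a \<le> h e" if "e \<in> E" "a \<in> e" "b \<in> e" for e a b
    unfolding h_def using lower[OF that] c
    by (intro real_le_rsqrt) (simp add: field_simps)
  have lap: "laplacian_form E m x = (\<Sum>e\<in>E. edge_form m e x)"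
    by (simp add: laplacian_form_def edge_form_def)

  have sumj: "(\<Sum>i\<in>V - {j}. x i ^ m) = 1"
    using sum1 xj m j finV by (simp add: sum_diff1)
  \<comment> \<open>The \<open>n - 1\<close> vertices other than \<open>j\<close> share the total
    mass 1.\<close>
  have "\<exists>i\<in>V - {j}. 1 / real (n - 1) \<le> x i ^ m"
  proof (rule ccontr)
    assume "\<not> ?thesis"
    moreover have "V - {j} \<noteq> {}" using sumj by (metis sum.empty zero_neq_one)
    ultimately have "(\<Sum>i\<in>V - {j}. x i ^ m) < (\<Sum>i\<in>V - {j}. 1 / real (n - 1))"
      using finV by (intro sum_strict_mono) (auto simp: not_le)
    also have "\<dots> \<le> 1"
      using j by (simp add: n_def)
    finally show False using sumj by simp
  qed
  then obtain i where i: "i \<in> V" "i \<noteq> j" "1 / real (n - 1) \<le> x i ^ m" by auto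
  have "2 = card {i, j}" using i by simp
  also have "\<dots> \<le> n" unfolding n_def using finV i j by (intro card_mono) auto
  finally have n: "2 \<le> n" .
  \<comment> \<open>Expanding \<open>(n - 2)\<^sup>2 \<ge> 0\<close> is the source of the constant
    4.\<close>
  have "4 * (real n - 1) \<le> (real n)\<^sup>2"
    using zero_le_power2[of "real n - 2"] by (simp add: power2_eq_square algebra_simps)
  then have "4 / (real n)\<^sup>2 \<le> 1 / real (n - 1)"
    using n by (simp add: field_simps of_nat_diff)
  also have "\<dots> \<le> (f i)\<^sup>2"
    using i x0 by (simp add: f_def)
  finally have fi: "4 / (real n)\<^sup>2 \<le> (f i)\<^sup>2" .
  have fj: "f j = 0" using xj m by (simp add: f_def)

  have "hdist V E j i \<le> Max (hdist V E j ` V)"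
    using finV i by simp
  also have "\<dots> \<le> hdiam V E"
    using finV j by (simp add: hdiam_def)
  finally obtain us where us: "hyperpath V E j us i" "length us - 1 \<le> D"
    using D hdist_path by metis
  \<comment> \<open>The walk starts at \<open>j\<close>, where \<open>f\<close> vanishes, so the
    increments along it add up to \<open>f i\<close>.\<close>
  then have "\<exists>G\<subseteq>E. card G \<le> length us - 1 \<and> f (last us) - f (hd us) \<le> (\<Sum>e\<in>G. h e)"
    using finE h by (intro walk_increment_le) (auto simp: hyperpath_def)
  then obtain G where G: "G \<subseteq> E" "card G \<le> D" "f i \<le> (\<Sum>e\<in>G. h e)"
    using us fj by (auto simp: hyperpath_def)
  have f0: "0 \<le> f i" using x0 i by (simp add: f_def)
  have "4 / (real n)\<^sup>2 \<le> (\<Sum>e\<in>G. h e)\<^sup>2"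
    using fi power_mono[OF G(3) f0, of 2] by simp
  \<comment> \<open>Cauchy-Schwarz costs a factor \<open>card G \<le> D\<close>. As \<open>G\<close>
    charges each edge once, its squares are then part of the sum over \<open>E\<close>.\<close>
  also have "\<dots> \<le> (\<Sum>e\<in>G. (h e)\<^sup>2) * card G"
    by (rule sum_squared_le_sum_of_squares)
  also have "\<dots> \<le> (\<Sum>e\<in>E. (h e)\<^sup>2) * real D"
    using G(1,2) finE by (intro mult_mono sum_mono2 sum_nonneg) auto
  also have "(\<Sum>e\<in>E. (h e)\<^sup>2) = laplacian_form E m x / c"
    using form0 c by (simp add: h_def lap sum_divide_distrib)
  finally have *: "4 / (real n)\<^sup>2 \<le> laplacian_form E m x / c * real D" .
  \<comment> \<open>The left side of \<open>*\<close> is positive, while \<open>D = 0\<close> would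
    make the right side 0.\<close>
  have D0: "0 < D"
  proof (rule ccontr)
    assume "\<not> 0 < D"
    with * n show False by (simp add: field_simps)
  qed
  with * c n have "4 * c / ((real n)\<^sup>2 * real D) \<le> laplacian_form E m x"
    by (simp add: field_simps)
  with D0 show ?thesis
    by (simp add: c_def n_def mult_ac)
qed

text \<open>Serves the case of infinite diameter, where the claimed bound is 0.\<close>

lemma laplacian_form_nonneg:
  assumes H: "hypergraph V E" and m: "2 \<le> m" and edges: "\<And>e. e \<in> E \<Longrightarrow> card e \<le> m"
    and x: "x \<in> feasible V m j"
  shows "0 \<le> laplacian_form E m x"
  unfolding laplacian_form_def edge_form_def[symmetric]
proof (rule sum_nonneg)
  fix e assume e: "e \<in> E"
  then have sub: "e \<subseteq> V" "finite e" "e \<noteq> {}"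
    using H by (auto simp: hypergraph_def intro: finite_subset)
  then obtain a where "a \<in> e" by blast
  then show "0 \<le> edge_form m e x"
    using edge_form_lower_bound[of e m x a a] sub m edges[OF e] x by (auto simp: feasible_def)
qed

theorem theorem3p1:
  fixes V :: "'v set" and E :: "'v set set" and n m s_min :: nat
  assumes "hypergraph V E" and "E \<noteq> {}"
    and "n = card V" and "m = max_edge_size E" and "s_min = min_edge_size E"
    and "2 \<le> m"
  shows "ereal (analytic_connectivity V E) \<ge>
    ereal (4 * real s_min) /
      (ereal ((real n)\<^sup>2 * real m * (real m - 1)) * ereal_of_enat (hdiam V E))"
proof -
  have finV: "finite V" and finE: "finite E"
    using assms(1) by (auto simp: hypergraph_def intro: finite_subset)
  have sub: "e \<subseteq> V" "finite e" "e \<noteq> {}" if "e \<in> E" for e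
    using assms(1) that by (auto simp: hypergraph_def intro: finite_subset)
  have edges: "s_min \<le> card e \<and> card e \<le> m" if "e \<in> E" for e
    using that finE by (simp add: assms min_edge_size_def max_edge_size_def)
  have "m \<in> card ` E"
    unfolding assms(4) max_edge_size_def using assms(2) finE by (intro Max_in) auto
  \<comment> \<open>Some edge has \<open>m \<ge> 2\<close> vertices, all of them in
    \<open>V\<close>.\<close>
  then have n: "2 \<le> card V"
    using sub(1) card_mono[OF finV] assms(6) by (metis (no_types) imageE le_trans)
  have "s_min \<in> card ` E"
    unfolding assms(5) min_edge_size_def using assms(2) finE by (intro Min_in) auto
  then have s: "0 < s_min"
    using sub by (auto simp: card_gt_0_iff)
  have V: "V \<noteq> {}" using n by auto
  \<comment> \<open>Nonempty feasible sets matter here: the infimum of an empty set of reals need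
    not inherit the bound.\<close>
  have bound: "B \<le> analytic_connectivity V E"
    if "\<And>j x. j \<in> V \<Longrightarrow> x \<in> feasible V m j \<Longrightarrow> B \<le> laplacian_form E m x" for B
    unfolding analytic_connectivity_def assms(4)[symmetric]
    using finV V feasible_nonempty[OF finV n] assms(6) that
    by (auto intro!: cINF_greatest)
  show ?thesis
  proof (cases "hdiam V E")
    case (enat D)
    note lower = laplacian_form_lower_bound[OF assms(1,6) edges s _ _ enat]
    \<comment> \<open>A feasible vector is exhibited because \<open>0 < D\<close> is available only
      from the bound for some vector.\<close>
    obtain j where j: "j \<in> V" using V by blast
    then obtain x where "x \<in> feasible V m j"
      using feasible_nonempty[OF finV n, of m j] assms(6) by auto
    then have "0 < D" using lower j by blast
    moreover have "4 * real s_min / ((real n)\<^sup>2 * real m * (real m - 1) * real D)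
        \<le> analytic_connectivity V E"
      unfolding assms(3) using lower by (intro bound) blast
    ultimately show ?thesis
      using n assms(3,6) by (simp add: enat)
  next
    case infinity
    have "0 \<le> analytic_connectivity V E"
      using laplacian_form_nonneg[OF assms(1,6)] edges by (intro bound) blast
    then show ?thesis
      using infinity n assms(3,6) by simp
  qed
qed

end
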